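(* Let $k$ be a field and let $\mathcal{C}$ be a finite right deterministic cancellative category. Then $\mathcal{X}^{\bullet}$ is a $k$-linear right inverse for $\mathcal{T}^{\bullet}$; that is, for every $m\ge 0$ the map $\mathcal{X}^m:C^m(kNF^{\mathrm{ad}}(\mathcal{C}),k)\to C^m(k\mathcal{C})$ is $k$-linear and $\mathcal{T}^m\circ\mathcal{X}^m=\mathrm{id}$.
   Context: A category is finite if it has finitely many objects and all its sets of morphisms are finite. For a morphism $a$, $s(a)$ and $t(a)$ are its source and target. The category algebra $k\mathcal{C}$ is the $k$-vector space with basis $\mathrm{Mor}(\mathcal{C})$ and product $ab=a\circ b$ if $s(a)=t(b)$, and $ab=0$ otherwise. $\mathcal{C}$ is right deterministic if for all $g\in\mathrm{Hom}_{\mathcal{C}}(x_1,x_2)$ and $a\in\mathrm{End}_{\mathcal{C}}(x_1)$ there is $b\in\mathrm{End}_{\mathcal{C}}(x_2)$ with $g\circ a=b\circ g$. Cancellative means composition is both left and right cancellable. $C^0(k\mathcal{C})=k\mathcal{C}$ and $C^m(k\mathcal{C})=\mathrm{Hom}_k((k\mathcal{C})^{\otimes m},k\mathcal{C})$ for $m\ge1$. For $X\in C^m(k\mathcal{C})$ write $X(g_{m-1}\otimes\cdots\otimes g_0)=\sum_{h\in\mathrm{Mor}(\mathcal{C})}X^h_{g_{m-1},\dots,g_0}h$ for $g_i\in\mathrm{Mor}(\mathcal{C})$ (and $X=\sum_h X^hh$ if $m=0$). The adjoint category $F^{\mathrm{ad}}(\mathcal{C})$ has as objects all endomorphisms in $\mathcal{C}$;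 a morphism from $a\in\mathrm{End}_{\mathcal{C}}(x_1)$ to $b\in\mathrm{End}_{\mathcal{C}}(x_2)$ is a $g\in\mathrm{Hom}_{\mathcal{C}}(x_1,x_2)$ with $g\circ a=b\circ g$. $NF^{\mathrm{ad}}(\mathcal{C})_m$ is the set of chains $\sigma=(a_0\xrightarrow{g_0}a_1\to\cdots\xrightarrow{g_{m-1}}a_m)$ of $m$ composable morphisms in $F^{\mathrm{ad}}(\mathcal{C})$ (objects, if $m=0$), and $C^m(kNF^{\mathrm{ad}}(\mathcal{C}),k)=\mathrm{Hom}_k(kNF^{\mathrm{ad}}(\mathcal{C})_m,k)$. The maps $\mathcal{T}^m:C^m(k\mathcal{C})\to C^m(kNF^{\mathrm{ad}}(\mathcal{C}),k)$: on the basis, $\mathcal{T}^m(X)(a_0\xrightarrow{g_0}\cdots\xrightarrow{g_{m-1}}a_m)=X_{g_{m-1},\dots,g_0}^{g_{m-1}\cdots g_1g_0a_0}$ for $m\ge1$, and $\mathcal{T}^0(X)(a_0)=X^{a_0}$. The maps $\mathcal{X}^m$: since $\mathcal{C}$ is right deterministic and right cancellative, for composable morphisms $g_{m-1},\dots,g_0$ of $\mathcal{C}$ and $a_0\in\mathrm{End}_{\mathcal{C}}(s(g_0))$ there are unique endomorphisms $a_1,\dots,a_m$ such that $\sigma(g_{m-1},\dots,g_0;a_0):=(a_0\xrightarrow{g_0}a_1\to\cdots\xrightarrow{g_{m-1}}a_m)$ is a chain in $F^{\mathrm{ad}}(\mathcal{C})$. For $T\in C^m(kNF^{\mathrm{ad}}(\mathcal{C}),k)$,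 $m\ge1$, and $g_0,\dots,g_{m-1}\in\mathrm{Mor}(\mathcal{C})$, set $$\mathcal{X}^m(T)(g_{m-1}\otimes\cdots\otimes g_0)=\sum_{a_0\in\mathrm{End}_{\mathcal{C}}(s(g_0))}T(\sigma(g_{m-1},\dots,g_0;a_0))\;g_{m-1}\cdots g_1g_0a_0$$ if $g_{m-1},\dots,g_0$ are composable, and $0$ otherwise, extended linearly. For $m=0$, $\mathcal{X}^0(T)=\sum_{a_0}T(a_0)a_0$, the sum over all endomorphisms $a_0$ of $\mathcal{C}$. *)

theory Defs
  imports Complex_Main "HOL-Library.Function_Algebras" "HOL-Library.Poly_Mapping"
begin

section \<open>Categories\<close>

record ('o, 'm) cat =
  Obj :: "'o set"
  Mor :: "'m set"
  Src :: "'m \<Rightarrow> 'o"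
  Tgt :: "'m \<Rightarrow> 'o"
  Ide :: "'o \<Rightarrow> 'm"
  Comp :: "'m \<Rightarrow> 'm \<Rightarrow> 'm"

text \<open>\<open>Comp C a b\<close> is \<open>a \<circ> b\<close>; it is meaningful only if \<open>Src C a = Tgt C b\<close>.\<close>

locale category =
  fixes C :: "('o, 'm) cat"
  assumes Src_in: "f \<in> Mor C \<Longrightarrow> Src C f \<in> Obj C"
    and Tgt_in: "f \<in> Mor C \<Longrightarrow> Tgt C f \<in> Obj C"
    and Ide_in: "x \<in> Obj C \<Longrightarrow> Ide C x \<in> Mor C"
    and Src_Ide: "x \<in> Obj C \<Longrightarrow> Src C (Ide C x) = x"
    and Tgt_Ide: "x \<in> Obj C \<Longrightarrow> Tgt C (Ide C x) = x"
    and Comp_in: "\<lbrakk>f \<in> Mor C; g \<in> Mor C; Src C f = Tgt C g\<rbrakk> \<Longrightarrow> Comp C f g \<in> Mor C"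
    and Src_Comp: "\<lbrakk>f \<in> Mor C; g \<in> Mor C; Src C f = Tgt C g\<rbrakk> \<Longrightarrow> Src C (Comp C f g) = Src C g"
    and Tgt_Comp: "\<lbrakk>f \<in> Mor C; g \<in> Mor C; Src C f = Tgt C g\<rbrakk> \<Longrightarrow> Tgt C (Comp C f g) = Tgt C f"
    and Comp_Ide: "f \<in> Mor C \<Longrightarrow> Comp C f (Ide C (Src C f)) = f"
    and Ide_Comp: "f \<in> Mor C \<Longrightarrow> Comp C (Ide C (Tgt C f)) f = f"
    and Comp_assoc: "\<lbrakk>f \<in> Mor C; g \<in> Mor C; h \<in> Mor C; Src C f = Tgt C g; Src C g = Tgt C h\<rbrakk>
      \<Longrightarrow> Comp C (Comp C f g) h = Comp C f (Comp C g h)"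

definition Hom :: "('o, 'm) cat \<Rightarrow> 'o \<Rightarrow> 'o \<Rightarrow> 'm set" where
  "Hom C x y = {f \<in> Mor C. Src C f = x \<and> Tgt C f = y}"

abbreviation End :: "('o, 'm) cat \<Rightarrow> 'o \<Rightarrow> 'm set" where
  "End C x \<equiv> Hom C x x"

definition endos :: "('o, 'm) cat \<Rightarrow> 'm set" where
  "endos C = (\<Union>x\<in>Obj C. End C x)"

definition finite_category :: "('o, 'm) cat \<Rightarrow> bool" where
  "finite_category C \<longleftrightarrow> finite (Obj C) \<and> (\<forall>x\<in>Obj C. \<forall>y\<in>Obj C. finite (Hom C x y))"

definition right_deterministic :: "('o, 'm) cat \<Rightarrow> bool" where
  "right_deterministic C \<longleftrightarrow>
     (\<forall>x1\<in>Obj C. \<forall>x2\<in>Obj C. \<forall>g\<in>Hom C x1 x2. \<forall>a\<in>End C x1. \<exists>b\<in>End C x2. Comp C g a = Comp C b g)"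

definition left_cancellative :: "('o, 'm) cat \<Rightarrow> bool" where
  "left_cancellative C \<longleftrightarrow>
     (\<forall>f\<in>Mor C. \<forall>a\<in>Mor C. \<forall>b\<in>Mor C.
        Src C f = Tgt C a \<longrightarrow> Src C f = Tgt C b \<longrightarrow> Comp C f a = Comp C f b \<longrightarrow> a = b)"

definition right_cancellative :: "('o, 'm) cat \<Rightarrow> bool" where
  "right_cancellative C \<longleftrightarrow>
     (\<forall>f\<in>Mor C. \<forall>a\<in>Mor C. \<forall>b\<in>Mor C.
        Src C a = Tgt C f \<longrightarrow> Src C b = Tgt C f \<longrightarrow> Comp C a f = Comp C b f \<longrightarrow> a = b)"

definition cancellative :: "('o, 'm) cat \<Rightarrow> bool" where
  "cancellative C \<longleftrightarrow> left_cancellative C \<and> right_cancellative C"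


section \<open>The adjoint category and nerves\<close>

text \<open>The same \<open>g\<close> may be a morphism between several pairs of endomorphisms, so a morphism
  \<open>g\<close> from \<open>a\<close> to \<open>b\<close> is represented by the triple \<open>(a, g, b)\<close>.\<close>

definition adjoint_category :: "('o, 'm) cat \<Rightarrow> ('m, 'm \<times> 'm \<times> 'm) cat" where
  "adjoint_category C = \<lparr>
     Obj = endos C,
     Mor = {(a, g, b). a \<in> endos C \<and> b \<in> endos C \<and>
              g \<in> Hom C (Src C a) (Src C b) \<and> Comp C g a = Comp C b g},
     Src = (\<lambda>(a, g, b). a),
     Tgt = (\<lambda>(a, g, b). b),
     Ide = (\<lambda>a. (a, Ide C (Src C a), a)),
     Comp = (\<lambda>(b, h, c) (a, g, b'). (a, Comp C h g, c))\<rparr>"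

definition underlying :: "'m \<times> 'm \<times> 'm \<Rightarrow> 'm" where
  "underlying = (\<lambda>(a, g, b). g)"

lemma category_adjoint_category:
  assumes "category C"
  shows "category (adjoint_category C)"
proof -
  interpret category C by fact
  have D: "a \<in> endos C \<longleftrightarrow> a \<in> Mor C \<and> Tgt C a = Src C a" for a
    using Src_in by (auto simp: endos_def Hom_def)
  have comp: "Comp C h (Comp C b g) = Comp C c (Comp C h g)"
    if "Comp C h b = Comp C c h" "b \<in> Mor C" "c \<in> Mor C" "g \<in> Mor C" "h \<in> Mor C"
      "Tgt C b = Src C b" "Tgt C c = Src C c" "Tgt C g = Src C b" "Src C h = Src C b" "Tgt C h = Src C c"
    for b c g h
    using that by (metis Comp_assoc)
  have ident: "Comp C (Ide C (Src C a)) a = Comp C a (Ide C (Src C a))"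
    if "a \<in> Mor C" "Tgt C a = Src C a" for a
    using that by (metis Comp_Ide Ide_Comp)
  show ?thesis
    by unfold_locales
      (auto simp: adjoint_category_def D Hom_def Ide_in Src_Ide Tgt_Ide Src_in Comp_in Src_Comp
         Tgt_Comp Comp_assoc ident comp,
       metis Comp_Ide, metis Ide_Comp)
qed

text \<open>\<open>path D x [f\<^sub>0, \<dots>, f\<^sub>n]\<close>: the morphisms \<open>f\<^sub>0, \<dots>, f\<^sub>n\<close> can be composed in this order
  (\<open>f\<^sub>0\<close> is applied first), starting at the object \<open>x\<close>.\<close>

fun path :: "('o, 'm) cat \<Rightarrow> 'o \<Rightarrow> 'm list \<Rightarrow> bool" where
  "path D x [] \<longleftrightarrow> x \<in> Obj D"
| "path D x (f # fs) \<longleftrightarrow> f \<in> Mor D \<and> Src D f = x \<and> path D (Tgt D f) fs"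

text \<open>A chain is represented by its initial object and its list of morphisms; the initial object is
  redundant unless the list is empty.\<close>

definition nerve :: "('o, 'm) cat \<Rightarrow> nat \<Rightarrow> ('o \<times> 'm list) set" where
  "nerve D m = {(x, fs). path D x fs \<and> length fs = m}"

text \<open>The chain \<open>a\<^sub>0 \<rightarrow> a\<^sub>1 \<rightarrow> \<dots> \<rightarrow> a\<^sub>m\<close> in the adjoint category determined by
  \<open>gs = [g\<^sub>0, \<dots>, g\<^sub>m\<^sub>-\<^sub>1]\<close> and \<open>a\<^sub>0\<close>.\<close>

definition lift_chain ::
    "('o, 'm) cat \<Rightarrow> 'm list \<Rightarrow> 'm \<Rightarrow> 'm \<times> ('m \<times> 'm \<times> 'm) list" where
  "lift_chain C gs a0 = (THE \<sigma>. \<sigma> \<in> nerve (adjoint_category C) (length gs) \<and>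
      fst \<sigma> = a0 \<and> map underlying (snd \<sigma>) = gs)"


section \<open>Vector spaces of finite formal sums\<close>

abbreviation lookup :: "('b \<Rightarrow>\<^sub>0 'k) \<Rightarrow> 'b \<Rightarrow> 'k::zero" where
  "lookup \<equiv> Poly_Mapping.lookup"

abbreviation keys :: "('b \<Rightarrow>\<^sub>0 'k::zero) \<Rightarrow> 'b set" where
  "keys \<equiv> Poly_Mapping.keys"

text \<open>\<open>free_space S\<close> is the vector space with basis \<open>S\<close>, i.e.\ the finite formal linear
  combinations of elements of \<open>S\<close>; the basis vector of \<open>b\<close> is \<open>basis b\<close>.\<close>

definition free_space :: "'b set \<Rightarrow> ('b \<Rightarrow>\<^sub>0 'k::field) set" where
  "free_space S = {v. keys v \<subseteq> S}"

definition fscale :: "'k \<Rightarrow> ('b \<Rightarrow>\<^sub>0 'k) \<Rightarrow> ('b \<Rightarrow>\<^sub>0 'k::field)" where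
  "fscale c = Poly_Mapping.map ((*) c)"

abbreviation basis :: "'b \<Rightarrow> ('b \<Rightarrow>\<^sub>0 'k::field)" where
  "basis b \<equiv> Poly_Mapping.single b 1"

definition linear_on :: "('k::field \<Rightarrow> 'v \<Rightarrow> 'v) \<Rightarrow> ('k \<Rightarrow> 'w \<Rightarrow> 'w) \<Rightarrow>
    'v::ab_group_add set \<Rightarrow> 'w::ab_group_add set \<Rightarrow> ('v \<Rightarrow> 'w) \<Rightarrow> bool" where
  "linear_on s1 s2 V W f \<longleftrightarrow>
     (\<forall>v\<in>V. f v \<in> W) \<and>
     (\<forall>u\<in>V. \<forall>v\<in>V. f (u + v) = f u + f v) \<and>
     (\<forall>c. \<forall>v\<in>V. f (s1 c v) = s2 c (f v))"

text \<open>Linear maps \<open>V \<rightarrow> W\<close>, normalised to be \<open>0\<close> off \<open>V\<close>, so that equality of the elements of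
  \<open>linear_maps\<close> is equality of maps on \<open>V\<close>, and the vector space operations are pointwise.\<close>

definition linear_maps :: "('k::field \<Rightarrow> 'v \<Rightarrow> 'v) \<Rightarrow> ('k \<Rightarrow> 'w \<Rightarrow> 'w) \<Rightarrow>
    'v::ab_group_add set \<Rightarrow> 'w::ab_group_add set \<Rightarrow> ('v \<Rightarrow> 'w) set" where
  "linear_maps s1 s2 V W = {f. linear_on s1 s2 V W f \<and> (\<forall>v. v \<notin> V \<longrightarrow> f v = 0)}"

definition map_scale :: "('k \<Rightarrow> 'w \<Rightarrow> 'w) \<Rightarrow> 'k \<Rightarrow> ('v \<Rightarrow> 'w) \<Rightarrow> ('v \<Rightarrow> 'w)" where
  "map_scale s c f = (\<lambda>v. s c (f v))"

text \<open>The element of \<open>linear_maps fscale s (free_space S) W\<close> with prescribed values \<open>\<phi>\<close> on \<open>S\<close>.\<close>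

definition lin_ext :: "('k::field \<Rightarrow> 'w \<Rightarrow> 'w) \<Rightarrow> 'b set \<Rightarrow> ('b \<Rightarrow> 'w) \<Rightarrow>
    ('b \<Rightarrow>\<^sub>0 'k) \<Rightarrow> 'w::ab_group_add" where
  "lin_ext s S \<phi> v = (if v \<in> free_space S then \<Sum>b\<in>keys v. s (lookup v b) (\<phi> b) else 0)"

lemma lookup_fscale [simp]: "lookup (fscale c v) b = c * lookup v b"
  by (simp add: fscale_def Poly_Mapping.map.rep_eq when_def)

lemma vector_space_fscale: "vector_space (fscale :: 'k::field \<Rightarrow> ('b \<Rightarrow>\<^sub>0 'k) \<Rightarrow> _)"
  by unfold_locales (auto intro!: poly_mapping_eqI simp: lookup_add algebra_simps)

lemma vector_space_map_scale:
  fixes s :: "'k::field \<Rightarrow> 'w \<Rightarrow> 'w::ab_group_add"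
  assumes "vector_space s"
  shows "vector_space (map_scale s :: 'k \<Rightarrow> ('v \<Rightarrow> 'w) \<Rightarrow> _)"
proof -
  interpret vector_space s by fact
  show ?thesis
    by unfold_locales
      (auto simp: map_scale_def fun_eq_iff scale_right_distrib scale_left_distrib)
qed

lemma vector_space_field: "vector_space ((*) :: 'k::field \<Rightarrow> _)"
  by unfold_locales (auto simp: algebra_simps)

lemma subspace_free_space: "module.subspace fscale (free_space S)"
proof -
  interpret vector_space fscale by (rule vector_space_fscale)
  show ?thesis
    by (rule subspaceI)
      (auto simp: free_space_def in_keys_iff subset_iff lookup_add, metis add.right_neutral)
qed

lemma subspace_linear_maps:
  fixes s1 :: "'k::field \<Rightarrow> 'v::ab_group_add \<Rightarrow> 'v" and s2 :: "'k \<Rightarrow> 'w::ab_group_add \<Rightarrow> 'w"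
  assumes s1: "vector_space s1" and s2: "vector_space s2"
    and V: "module.subspace s1 V" and W: "module.subspace s2 W"
  shows "module.subspace (map_scale s2) (linear_maps s1 s2 V W)"
proof -
  interpret s1: vector_space s1 by fact
  interpret s2: vector_space s2 by fact
  interpret m: vector_space "map_scale s2 :: 'k \<Rightarrow> ('v \<Rightarrow> 'w) \<Rightarrow> _"
    by (rule vector_space_map_scale) fact
  show ?thesis
    by (rule m.subspaceI)
      (auto simp: linear_maps_def linear_on_def map_scale_def
         s2.subspace_0[OF W] s2.subspace_add[OF W] s2.subspace_scale[OF W]
         s2.scale_right_distrib mult.commute)
qed

lemma keys_sum_superset:
  fixes s :: "'k::field \<Rightarrow> 'w \<Rightarrow> 'w::ab_group_add"
  assumes "vector_space s" "finite A" "keys v \<subseteq> A"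
  shows "(\<Sum>b\<in>keys v. s (lookup v b) (\<phi> b)) = (\<Sum>b\<in>A. s (lookup v b) (\<phi> b))"
proof -
  interpret vector_space s by fact
  show ?thesis
    using assms(2,3) by (intro sum.mono_neutral_left) (auto simp: in_keys_iff)
qed

lemma lin_ext_linear:
  fixes s :: "'k::field \<Rightarrow> 'w \<Rightarrow> 'w::ab_group_add"
  assumes s: "vector_space s"
  shows "lin_ext s S \<phi> \<in> linear_maps fscale s (free_space S) UNIV"
proof -
  interpret s: vector_space s by fact
  interpret f: vector_space "fscale :: 'k \<Rightarrow> ('a \<Rightarrow>\<^sub>0 'k) \<Rightarrow> _" by (rule vector_space_fscale)
  have add: "lin_ext s S \<phi> (u + v) = lin_ext s S \<phi> u + lin_ext s S \<phi> v"
    if u: "u \<in> free_space S" and v: "v \<in> free_space S" for u v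
  proof -
    let ?A = "keys u \<union> keys v"
    have uv: "u + v \<in> free_space S"
      by (rule f.subspace_add[OF subspace_free_space u v])
    have "(\<Sum>b\<in>keys (u + v). s (lookup (u + v) b) (\<phi> b)) = (\<Sum>b\<in>?A. s (lookup (u + v) b) (\<phi> b))"
      by (rule keys_sum_superset[OF s]) (auto simp: keys_add)
    moreover have "(\<Sum>b\<in>keys u. s (lookup u b) (\<phi> b)) = (\<Sum>b\<in>?A. s (lookup u b) (\<phi> b))"
      by (rule keys_sum_superset[OF s]) auto
    moreover have "(\<Sum>b\<in>keys v. s (lookup v b) (\<phi> b)) = (\<Sum>b\<in>?A. s (lookup v b) (\<phi> b))"
      by (rule keys_sum_superset[OF s]) auto
    ultimately show ?thesis
      using u v uv by (simp add: lin_ext_def lookup_add s.scale_left_distrib sum.distrib)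
  qed
  have scale: "lin_ext s S \<phi> (fscale c v) = s c (lin_ext s S \<phi> v)"
    if v: "v \<in> free_space S" for c v
  proof -
    have cv: "fscale c v \<in> free_space S"
      by (rule f.subspace_scale[OF subspace_free_space v])
    have "(\<Sum>b\<in>keys (fscale c v). s (lookup (fscale c v) b) (\<phi> b))
        = (\<Sum>b\<in>keys v. s (lookup (fscale c v) b) (\<phi> b))"
      by (rule keys_sum_superset[OF s]) (auto simp: in_keys_iff)
    then show ?thesis
      using v cv by (simp add: lin_ext_def s.scale_sum_right)
  qed
  show ?thesis
    by (auto simp: linear_maps_def linear_on_def add scale) (simp add: lin_ext_def)
qed

lemma lin_ext_basis:
  fixes s :: "'k::field \<Rightarrow> 'w \<Rightarrow> 'w::ab_group_add"
  assumes "vector_space s" "b \<in> S"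
  shows "lin_ext s S \<phi> (basis b) = \<phi> b"
proof -
  interpret s: vector_space s by fact
  show ?thesis using assms(2) by (simp add: lin_ext_def free_space_def)
qed


section \<open>Tensor powers\<close>

text \<open>The \<open>m\<close>-th tensor power of \<open>free_space S\<close> is modelled as the vector space on the words of
  length \<open>m\<close> over \<open>S\<close>; \<open>tensor [v\<^sub>1, \<dots>, v\<^sub>m]\<close> is \<open>v\<^sub>1 \<otimes> \<dots> \<otimes> v\<^sub>m\<close>. The universal property is
  \<open>tensor_power_universal\<close> below.\<close>

definition words :: "nat \<Rightarrow> 'b set \<Rightarrow> 'b list set" where
  "words m S = {bs. length bs = m \<and> set bs \<subseteq> S}"

definition tensor_power :: "nat \<Rightarrow> 'b set \<Rightarrow> ('b list \<Rightarrow>\<^sub>0 'k::field) set" where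
  "tensor_power m S = free_space (words m S)"

fun tensor :: "('b \<Rightarrow>\<^sub>0 'k::field) list \<Rightarrow> ('b list \<Rightarrow>\<^sub>0 'k)" where
  "tensor [] = basis []"
| "tensor (v # vs) =
     (\<Sum>b\<in>keys v. \<Sum>bs\<in>keys (tensor vs). Poly_Mapping.single (b # bs) (lookup v b * lookup (tensor vs) bs))"

lemma tensor_basis: "tensor (map basis bs) = basis bs"
  by (induction bs) auto

definition multilinear_on :: "('k::field \<Rightarrow> 'v \<Rightarrow> 'v) \<Rightarrow> ('k \<Rightarrow> 'w \<Rightarrow> 'w) \<Rightarrow>
    'v::ab_group_add set \<Rightarrow> nat \<Rightarrow> ('v list \<Rightarrow> 'w::ab_group_add) \<Rightarrow> bool" where
  "multilinear_on s1 s2 V m F \<longleftrightarrow>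
     (\<forall>us vs. set us \<subseteq> V \<longrightarrow> set vs \<subseteq> V \<longrightarrow> Suc (length us + length vs) = m \<longrightarrow>
        linear_on s1 s2 V UNIV (\<lambda>v. F (us @ v # vs)))"

lemma free_space_expand: "v = (\<Sum>b\<in>keys v. fscale (lookup v b) (basis b))"
  by (rule poly_mapping_eqI)
    (auto simp: lookup_sum lookup_single when_def in_keys_iff if_distrib[where f = "(*) _"]
      sum.delta' cong: if_cong)

lemma linear_on_expand:
  fixes s :: "'k::field \<Rightarrow> 'w \<Rightarrow> 'w::ab_group_add"
  assumes s: "vector_space s" and f: "linear_on fscale s (free_space S) W f"
    and v: "v \<in> free_space S"
  shows "f v = (\<Sum>b\<in>keys v. s (lookup v b) (f (basis b)))"
proof -
  interpret s: vector_space s by fact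
  interpret f: vector_space "fscale :: 'k \<Rightarrow> ('a \<Rightarrow>\<^sub>0 'k) \<Rightarrow> _" by (rule vector_space_fscale)
  have [simp]: "(basis b :: 'a \<Rightarrow>\<^sub>0 'k) \<in> free_space S" if "b \<in> S" for b
    using that by (simp add: free_space_def)
  have in_fs: "fscale c (basis b) \<in> free_space S" if "b \<in> S" for c :: 'k and b
    using that by (intro f.subspace_scale[OF subspace_free_space]) auto
  have f0: "f 0 = 0"
    using f f.subspace_0[OF subspace_free_space, of S] unfolding linear_on_def
    by (metis add_cancel_right_right)
  have "f (\<Sum>b\<in>A. fscale (lookup v b) (basis b)) = (\<Sum>b\<in>A. s (lookup v b) (f (basis b)))"
    if "finite A" "A \<subseteq> S" for A
    using that
  proof (induction A rule: finite_induct)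
    case empty
    then show ?case by (simp add: f0)
  next
    case (insert x A)
    have "(\<Sum>b\<in>A. fscale (lookup v b) (basis b)) \<in> free_space S"
      using insert.prems by (intro f.subspace_sum[OF subspace_free_space] in_fs) auto
    then show ?case
      using insert f in_fs by (simp add: linear_on_def)
  qed
  from this[of "keys v"] v show ?thesis
    by (simp add: free_space_def flip: free_space_expand)
qed

lemma tensor_in:
  fixes vs :: "('b \<Rightarrow>\<^sub>0 'k::field) list"
  shows "set vs \<subseteq> free_space S \<Longrightarrow> tensor vs \<in> tensor_power (length vs) S"
proof (induction vs)
  case Nil
  then show ?case by (simp add: tensor_power_def free_space_def words_def)
next
  case (Cons v vs)
  interpret f: vector_space "fscale :: 'k \<Rightarrow> ('b list \<Rightarrow>\<^sub>0 'k) \<Rightarrow> _" by (rule vector_space_fscale)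
  show ?case
    using Cons unfolding tensor_power_def tensor.simps
    by (intro f.subspace_sum[OF subspace_free_space])
      (auto simp: free_space_def words_def subset_iff)
qed

theorem tensor_power_universal:
  fixes s :: "'k::field \<Rightarrow> 'w \<Rightarrow> 'w::ab_group_add"
  assumes s: "vector_space s" and F: "multilinear_on fscale s (free_space S) m F"
  shows "\<exists>!f. f \<in> linear_maps fscale s (tensor_power m S) UNIV \<and>
    (\<forall>vs. length vs = m \<and> set vs \<subseteq> free_space S \<longrightarrow> f (tensor vs) = F vs)"
proof (rule ex1I, intro conjI allI impI)
  interpret s: vector_space s by fact
  let ?f = "lin_ext s (words m S) (\<lambda>bs. F (map basis bs))"
  show "?f \<in> linear_maps fscale s (tensor_power m S) UNIV"
    unfolding tensor_power_def by (rule lin_ext_linear[OF s])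
  have main: "F (map basis bs @ vs)
      = (\<Sum>l\<in>keys (tensor vs). s (lookup (tensor vs) l) (F (map basis (bs @ l))))"
    if "set bs \<subseteq> S" "set vs \<subseteq> free_space S" "length bs + length vs = m" for bs vs
    using that
  proof (induction vs arbitrary: bs)
    case Nil
    then show ?case by simp
  next
    case (Cons v vs)
    have v: "v \<in> free_space S" using Cons by simp
    have "linear_on fscale s (free_space S) UNIV (\<lambda>v. F (map basis bs @ v # vs))"
    proof -
      have "set (map basis bs) \<subseteq> (free_space S :: ('a \<Rightarrow>\<^sub>0 'k) set)"
        using Cons.prems by (auto simp: free_space_def)
      then show ?thesis
        using F Cons.prems unfolding multilinear_on_def by simp
    qed
    from linear_on_expand[OF s this v]
    have "F (map basis bs @ v # vs)
        = (\<Sum>b\<in>keys v. s (lookup v b) (F (map basis (bs @ [b]) @ vs)))" by simp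
    also have "\<dots> = (\<Sum>b\<in>keys v. s (lookup v b)
        (\<Sum>l\<in>keys (tensor vs). s (lookup (tensor vs) l) (F (map basis ((bs @ [b]) @ l)))))"
      using Cons.prems v
      by (intro sum.cong refl arg_cong[where f = "s _"] Cons.IH) (auto simp: free_space_def)
    also have "\<dots> = (\<Sum>b\<in>keys v. \<Sum>l\<in>keys (tensor vs).
        s (lookup v b * lookup (tensor vs) l) (F (map basis (bs @ b # l))))"
      by (simp add: s.scale_sum_right)
    also have "\<dots> = (\<Sum>l\<in>keys (tensor (v # vs)).
        s (lookup (tensor (v # vs)) l) (F (map basis (bs @ l))))"
    proof -
      let ?g = "lin_ext s UNIV (\<lambda>l. F (map basis (bs @ l)))"
      have lin: "linear_on fscale s UNIV UNIV ?g"
        using lin_ext_linear[OF s, of UNIV] by (simp add: linear_maps_def free_space_def)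
      have gsum: "?g (sum h A) = (\<Sum>x\<in>A. ?g (h x))" if "finite A"
        for h :: "'a list \<Rightarrow> ('a list \<Rightarrow>\<^sub>0 'k)" and A
        using that lin by (induction A rule: finite_induct) (auto simp: linear_on_def lin_ext_def)
      have gsum': "?g (sum h A) = (\<Sum>x\<in>A. ?g (h x))" if "finite A"
        for h :: "'a \<Rightarrow> ('a list \<Rightarrow>\<^sub>0 'k)" and A
        using that lin by (induction A rule: finite_induct) (auto simp: linear_on_def lin_ext_def)
      have gsingle: "?g (Poly_Mapping.single l c) = s c (F (map basis (bs @ l)))" for l c
        by (simp add: lin_ext_def free_space_def)
      have "?g (tensor (v # vs)) = (\<Sum>b\<in>keys v. \<Sum>l\<in>keys (tensor vs).
          s (lookup v b * lookup (tensor vs) l) (F (map basis (bs @ b # l))))"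
        by (simp add: gsum gsum' gsingle del: map_append)
      then show ?thesis by (simp add: lin_ext_def free_space_def)
    qed
    finally show ?case .
  qed
  fix vs :: "('a \<Rightarrow>\<^sub>0 'k) list"
  assume vs: "length vs = m \<and> set vs \<subseteq> free_space S"
  have "tensor vs \<in> free_space (words m S)"
    using tensor_in[of vs S] vs by (simp add: tensor_power_def)
  then show "?f (tensor vs) = F vs"
    using main[of "[]" vs] vs by (simp add: lin_ext_def)
next
  interpret s: vector_space s by fact
  let ?f = "lin_ext s (words m S) (\<lambda>bs. F (map basis bs))"
  fix f
  assume f: "f \<in> linear_maps fscale s (tensor_power m S) UNIV \<and>
    (\<forall>vs. length vs = m \<and> set vs \<subseteq> free_space S \<longrightarrow> f (tensor vs) = F vs)"
  show "f = ?f"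
  proof
    fix t
    show "f t = ?f t"
    proof (cases "t \<in> free_space (words m S)")
      case True
      have lin: "linear_on fscale s (free_space (words m S)) UNIV f"
        using f by (simp add: linear_maps_def tensor_power_def)
      have "f (basis bs) = F (map basis bs)" if "bs \<in> keys t" for bs
      proof -
        have "length bs = m" "set (map basis bs) \<subseteq> (free_space S :: ('a \<Rightarrow>\<^sub>0 'k) set)"
          using that True by (fastforce simp: free_space_def words_def)+
        then have "f (tensor (map basis bs)) = F (map basis bs)" using f by simp
        then show ?thesis by (simp add: tensor_basis)
      qed
      then show ?thesis
        using linear_on_expand[OF s lin True] True by (simp add: lin_ext_def)
    next
      case False
      then show ?thesis using f by (auto simp: linear_maps_def tensor_power_def lin_ext_def)
    qed
  qed
qed


section \<open>Cochains and the comparison maps\<close>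

text \<open>In degree \<open>0\<close> the Hochschild cochains are the elements of \<open>free_space (Mor C)\<close>, the underlying
  vector space of the category algebra; the following are the Hochschild cochains in
  degree \<open>m \<ge> 1\<close>.\<close>

definition hochschild_cochains ::
    "('o, 'm) cat \<Rightarrow> nat \<Rightarrow> (('m list \<Rightarrow>\<^sub>0 'k::field) \<Rightarrow> ('m \<Rightarrow>\<^sub>0 'k)) set" where
  "hochschild_cochains C m =
     linear_maps fscale fscale (tensor_power m (Mor C)) (free_space (Mor C))"

definition nerve_cochains ::
    "('o, 'm) cat \<Rightarrow> nat \<Rightarrow> (('o \<times> 'm list \<Rightarrow>\<^sub>0 'k::field) \<Rightarrow> 'k) set" where
  "nerve_cochains D m = linear_maps fscale (*) (free_space (nerve D m)) UNIV"

text \<open>Lists of morphisms are in path order \<open>[g\<^sub>0, \<dots>, g\<^sub>m\<^sub>-\<^sub>1]\<close>, whereas the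
  tensor factors are in the order \<open>g\<^sub>m\<^sub>-\<^sub>1 \<otimes> \<dots> \<otimes> g\<^sub>0\<close>; hence the reversals below. Moreover,
  \<open>fold (Comp C) [g\<^sub>0, \<dots>, g\<^sub>m\<^sub>-\<^sub>1] a\<^sub>0\<close> is \<open>g\<^sub>m\<^sub>-\<^sub>1 \<circ> \<dots> \<circ> g\<^sub>0 \<circ> a\<^sub>0\<close>.\<close>

definition T_zero :: "('o, 'm) cat \<Rightarrow> ('m \<Rightarrow>\<^sub>0 'k::field) \<Rightarrow>
    ('m \<times> ('m \<times> 'm \<times> 'm) list \<Rightarrow>\<^sub>0 'k) \<Rightarrow> 'k" where
  "T_zero C X = lin_ext (*) (nerve (adjoint_category C) 0) (\<lambda>(a0, _). lookup X a0)"

definition T_map :: "('o, 'm) cat \<Rightarrow> nat \<Rightarrow> (('m list \<Rightarrow>\<^sub>0 'k::field) \<Rightarrow> ('m \<Rightarrow>\<^sub>0 'k)) \<Rightarrow>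
    ('m \<times> ('m \<times> 'm \<times> 'm) list \<Rightarrow>\<^sub>0 'k) \<Rightarrow> 'k" where
  "T_map C m X = lin_ext (*) (nerve (adjoint_category C) m)
     (\<lambda>(a0, fs). let gs = map underlying fs
        in lookup (X (tensor (map basis (rev gs)))) (fold (Comp C) gs a0))"

definition X_zero :: "('o, 'm) cat \<Rightarrow> (('m \<times> ('m \<times> 'm \<times> 'm) list \<Rightarrow>\<^sub>0 'k::field) \<Rightarrow> 'k) \<Rightarrow>
    ('m \<Rightarrow>\<^sub>0 'k)" where
  "X_zero C T = (\<Sum>a0\<in>endos C. fscale (T (basis (a0, []))) (basis a0))"

definition X_map :: "('o, 'm) cat \<Rightarrow> nat \<Rightarrow> (('m \<times> ('m \<times> 'm \<times> 'm) list \<Rightarrow>\<^sub>0 'k::field) \<Rightarrow> 'k) \<Rightarrow>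
    ('m list \<Rightarrow>\<^sub>0 'k) \<Rightarrow> ('m \<Rightarrow>\<^sub>0 'k)" where
  "X_map C m T = lin_ext fscale (words m (Mor C))
     (\<lambda>hs. let gs = rev hs; x0 = Src C (hd gs)
        in if path C x0 gs
           then \<Sum>a0\<in>End C x0. fscale (T (basis (lift_chain C gs a0))) (basis (fold (Comp C) gs a0))
           else 0)"

end

theory Submission
  imports Defs
begin

text \<open>On a chain with underlying morphisms \<open>g\<^sub>0, \<dots>, g\<^sub>m\<^sub>-\<^sub>1\<close> and initial object \<open>a\<^sub>0\<close>, the map \<open>T \<circ> X\<close>
  reads off the coefficient of \<open>g\<^sub>m\<^sub>-\<^sub>1 \<cdots> g\<^sub>0 a\<^sub>0\<close> in a sum over all endomorphisms \<open>a\<close> of the source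
  of \<open>g\<^sub>0\<close>. By left cancellation only the summand \<open>a = a\<^sub>0\<close> contributes, and by right cancellation
  the lift of \<open>g\<^sub>0, \<dots>, g\<^sub>m\<^sub>-\<^sub>1\<close> at \<open>a\<^sub>0\<close> is the given chain.\<close>

text \<open>Additivity here is in the prescribed values, not in the vector: \<open>X_map\<close>
  depends on the cochain \<open>T\<close> only through such values.\<close>

lemma lin_ext_add:
  assumes "vector_space s"
  shows "lin_ext s S (\<lambda>b. \<phi> b + \<psi> b) = lin_ext s S \<phi> + lin_ext s S \<psi>"
proof -
  interpret vector_space s by fact
  show ?thesis
    by (rule ext) (simp add: lin_ext_def scale_right_distrib sum.distrib)
qed

lemma lin_ext_scale:
  assumes "vector_space s"
  shows "lin_ext s S (\<lambda>b. s c (\<phi> b)) = map_scale s c (lin_ext s S \<phi>)"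
proof -
  interpret vector_space s by fact
  show ?thesis
    by (rule ext) (simp add: lin_ext_def map_scale_def scale_sum_right mult.commute)
qed

text \<open>Values on \<open>free_space S\<close> are finite linear combinations of the prescribed
  ones, so a subspace containing the latter contains the former.\<close>

lemma lin_ext_in_linear_maps:
  fixes s :: "'k::field \<Rightarrow> 'w \<Rightarrow> 'w::ab_group_add"
  assumes s: "vector_space s" and W: "module.subspace s W" and "\<And>b. b \<in> S \<Longrightarrow> \<phi> b \<in> W"
  shows "lin_ext s S \<phi> \<in> linear_maps fscale s (free_space S) W"
proof -
  interpret vector_space s by fact
  have "lin_ext s S \<phi> v \<in> W" if "v \<in> free_space S" for v
    using that assms(3)
    by (auto simp: lin_ext_def free_space_def intro!: subspace_sum[OF W] subspace_scale[OF W])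
  with lin_ext_linear[OF s] show ?thesis
    by (simp add: linear_maps_def linear_on_def)
qed

text \<open>A linear map on a free space is determined by the basis, and both sides vanish off
  \<open>free_space S\<close>. This reduces \<open>T \<circ> X = id\<close> to single
  chains.\<close>

lemma lin_ext_eqI:
  fixes s :: "'k::field \<Rightarrow> 'w \<Rightarrow> 'w::ab_group_add"
  assumes s: "vector_space s" and f: "f \<in> linear_maps fscale s (free_space S) W"
    and "\<And>b. b \<in> S \<Longrightarrow> \<phi> b = f (basis b)"
  shows "lin_ext s S \<phi> = f"
proof
  fix v
  show "lin_ext s S \<phi> v = f v"
  proof (cases "v \<in> free_space S")
    case True
    have "linear_on fscale s (free_space S) W f"
      using f by (simp add: linear_maps_def)
    from linear_on_expand[OF s this True] True assms(3) show ?thesis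
      by (auto simp: lin_ext_def free_space_def intro!: sum.cong)
  next
    case False
    then show ?thesis using f by (simp add: lin_ext_def linear_maps_def)
  qed
qed

lemma sum_fscale_basis_in_free_space:
  assumes "\<And>a. a \<in> A \<Longrightarrow> h a \<in> S"
  shows "(\<Sum>a\<in>A. fscale (c a) (basis (h a))) \<in> (free_space S :: ('b \<Rightarrow>\<^sub>0 'k::field) set)"
proof -
  interpret vector_space "fscale :: 'k \<Rightarrow> ('b \<Rightarrow>\<^sub>0 'k) \<Rightarrow> _" by (rule vector_space_fscale)
  show ?thesis
    using assms
    by (intro subspace_sum[OF subspace_free_space] subspace_scale[OF subspace_free_space])
      (simp add: free_space_def)
qed

text \<open>Injectivity of \<open>h\<close> keeps distinct summands on distinct basis vectors, so
  coefficients cannot accumulate.\<close>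

lemma lookup_sum_fscale_basis:
  assumes "finite A" "inj_on h A" "a \<in> A"
  shows "lookup (\<Sum>a\<in>A. fscale (c a) (basis (h a))) (h a) = (c a :: 'k::field)"
proof -
  have "lookup (\<Sum>a\<in>A. fscale (c a) (basis (h a))) (h a) = (\<Sum>b\<in>A. if b = a then c b else 0)"
    using assms unfolding lookup_sum
    by (intro sum.cong) (auto simp: lookup_single when_def inj_on_def)
  also have "\<dots> = c a" using assms by simp
  finally show ?thesis .
qed

lemma (in category) endos_iff: "a \<in> endos C \<longleftrightarrow> a \<in> End C (Src C a)"
  using Src_in by (auto simp: endos_def Hom_def)

lemma finite_endos: "finite_category C \<Longrightarrow> finite (endos C)"
  by (auto simp: finite_category_def endos_def)

lemma (in category) fold_Comp_in:
  "\<lbrakk>path C x gs; a \<in> Mor C; Tgt C a = x\<rbrakk> \<Longrightarrow> fold (Comp C) gs a \<in> Mor C"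
  by (induction gs arbitrary: x a) (auto simp: Comp_in Tgt_Comp)

text \<open>\<open>fold\<close> applies the first morphism \<open>g\<close> first, so the induction
  hypothesis for the remaining path identifies \<open>g a\<close> with \<open>g b\<close>; left
  cancellation then removes \<open>g\<close>.\<close>

lemma (in category) fold_Comp_inj:
  assumes "left_cancellative C"
  shows "\<lbrakk>path C x gs; a \<in> Mor C; Tgt C a = x; b \<in> Mor C; Tgt C b = x;
    fold (Comp C) gs a = fold (Comp C) gs b\<rbrakk> \<Longrightarrow> a = b"
proof (induction gs arbitrary: x a b)
  case (Cons g gs)
  have g: "g \<in> Mor C" "Src C g = Tgt C a" "Src C g = Tgt C b" "path C (Tgt C g) gs"
    using Cons.prems by simp_all
  have "Comp C g a = Comp C g b"
    by (rule Cons.IH[OF g(4)]) (use Cons.prems(2,4,6) g in \<open>simp_all add: Comp_in Tgt_Comp\<close>)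
  with assms g Cons.prems(2,4) show ?case
    unfolding left_cancellative_def by blast
qed simp

lemma path_subset_Mor: "path D x fs \<Longrightarrow> set fs \<subseteq> Mor D"
  by (induction fs arbitrary: x) auto

lemma (in category) path_underlying:
  "path (adjoint_category C) a fs \<Longrightarrow> a \<in> endos C \<and> path C (Src C a) (map underlying fs)"
proof (induction fs arbitrary: a)
  case Nil
  then show ?case by (auto simp: adjoint_category_def endos_def Hom_def)
next
  case (Cons f fs)
  obtain a' g b where f: "f = (a', g, b)" by (cases f)
  from Cons.prems have *: "a \<in> endos C" "g \<in> Mor C" "Src C g = Src C a" "Tgt C g = Src C b"
    "path (adjoint_category C) b fs"
    by (auto simp: f adjoint_category_def Hom_def)
  with Cons.IH[OF *(5)] show ?case
    by (simp add: f underlying_def)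
qed

text \<open>If \<open>g\<close> leads from \<open>a\<close> to both \<open>b\<close> and
  \<open>b'\<close>, then \<open>b g = g a = b' g\<close>, and right cancellation gives
  \<open>b = b'\<close>. Thus each arrow determines where the next one starts.\<close>

lemma (in category) path_adjoint_unique:
  assumes "right_cancellative C"
  shows "\<lbrakk>path (adjoint_category C) a fs; path (adjoint_category C) a fs';
    map underlying fs = map underlying fs'\<rbrakk> \<Longrightarrow> fs = fs'"
proof (induction fs arbitrary: a fs')
  case (Cons f fs)
  then obtain f' fs'' where fs': "fs' = f' # fs''" by (cases fs') auto
  \<comment> \<open>Both first arrows start at \<open>a\<close> and have the same underlying
    morphism, so only their targets could differ.\<close>
  obtain g b b' where f: "f = (a, g, b)" "f' = (a, g, b')"
    using Cons.prems
    by (cases f; cases f') (auto simp: fs' adjoint_category_def underlying_def)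
  have "b \<in> Mor C" "b' \<in> Mor C" "g \<in> Mor C" "Src C b = Tgt C g" "Src C b' = Tgt C g"
    "Comp C b g = Comp C b' g"
    using Cons.prems by (auto simp: fs' f adjoint_category_def endos_def Hom_def)
  with assms have "f = f'"
    unfolding f right_cancellative_def by blast
  then show ?case using Cons by (auto simp: fs')
qed simp

text \<open>The given path witnesses existence for the \<open>THE\<close>, and
  \<open>path_adjoint_unique\<close> supplies uniqueness.\<close>

lemma (in category) lift_chain_eq:
  assumes "right_cancellative C" "path (adjoint_category C) a fs"
  shows "lift_chain C (map underlying fs) a = (a, fs)"
  unfolding lift_chain_def
proof (rule the_equality)
  show "(a, fs) \<in> nerve (adjoint_category C) (length (map underlying fs)) \<and>
      fst (a, fs) = a \<and> map underlying (snd (a, fs)) = map underlying fs"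
    using assms(2) by (simp add: nerve_def)
next
  fix \<sigma>
  assume "\<sigma> \<in> nerve (adjoint_category C) (length (map underlying fs)) \<and>
      fst \<sigma> = a \<and> map underlying (snd \<sigma>) = map underlying fs"
  then have "fst \<sigma> = a" "path (adjoint_category C) a (snd \<sigma>)"
    "map underlying (snd \<sigma>) = map underlying fs"
    by (auto simp: nerve_def)
  with path_adjoint_unique[OF assms(1) this(2) assms(2) this(3)] show "\<sigma> = (a, fs)"
    by (simp add: prod_eq_iff)
qed

theorem proposition9:
  fixes C :: "('o, 'm) cat"
  assumes "category C" and "finite_category C" and "right_deterministic C" and "cancellative C"
  shows
    "linear_on (map_scale (*)) fscale
       (nerve_cochains (adjoint_category C) 0 ::
          (('m \<times> ('m \<times> 'm \<times> 'm) list \<Rightarrow>\<^sub>0 'k::field) \<Rightarrow> 'k) set)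
       (free_space (Mor C)) (X_zero C) \<and>
     (\<forall>T \<in> (nerve_cochains (adjoint_category C) 0 ::
          (('m \<times> ('m \<times> 'm \<times> 'm) list \<Rightarrow>\<^sub>0 'k::field) \<Rightarrow> 'k) set).
        T_zero C (X_zero C T) = T) \<and>
     (\<forall>m\<ge>1.
        linear_on (map_scale (*)) (map_scale fscale)
          (nerve_cochains (adjoint_category C) m ::
             (('m \<times> ('m \<times> 'm \<times> 'm) list \<Rightarrow>\<^sub>0 'k::field) \<Rightarrow> 'k) set)
          (hochschild_cochains C m) (X_map C m) \<and>
        (\<forall>T \<in> (nerve_cochains (adjoint_category C) m ::
             (('m \<times> ('m \<times> 'm \<times> 'm) list \<Rightarrow>\<^sub>0 'k::field) \<Rightarrow> 'k) set).
           T_map C m (X_map C m T) = T))"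
proof (intro conjI ballI allI impI)
  interpret category C by fact
  interpret f: vector_space "fscale :: 'k \<Rightarrow> ('m \<Rightarrow>\<^sub>0 'k) \<Rightarrow> _" by (rule vector_space_fscale)
  have rc: "right_cancellative C" and lc: "left_cancellative C"
    using assms(4) by (auto simp: cancellative_def)
  show "linear_on (map_scale (*)) fscale
       (nerve_cochains (adjoint_category C) 0 ::
          (('m \<times> ('m \<times> 'm \<times> 'm) list \<Rightarrow>\<^sub>0 'k::field) \<Rightarrow> 'k) set)
       (free_space (Mor C)) (X_zero C)"
    unfolding linear_on_def
  proof (intro conjI ballI allI)
    fix T :: "('m \<times> ('m \<times> 'm \<times> 'm) list \<Rightarrow>\<^sub>0 'k) \<Rightarrow> 'k"
    show "X_zero C T \<in> free_space (Mor C)"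
      unfolding X_zero_def
      by (rule sum_fscale_basis_in_free_space) (auto simp: endos_def Hom_def)
  qed (simp_all add: X_zero_def map_scale_def f.scale_left_distrib sum.distrib f.scale_sum_right)
  show "T_zero C (X_zero C T) = T"
    if "T \<in> nerve_cochains (adjoint_category C) 0"
    for T :: "('m \<times> ('m \<times> 'm \<times> 'm) list \<Rightarrow>\<^sub>0 'k) \<Rightarrow> 'k"
    unfolding T_zero_def
  proof (rule lin_ext_eqI[OF vector_space_field that[unfolded nerve_cochains_def]])
    fix \<sigma> assume "\<sigma> \<in> nerve (adjoint_category C) 0"
    then obtain a where \<sigma>: "\<sigma> = (a, [])" "a \<in> endos C"
      by (auto simp: nerve_def adjoint_category_def)
    then show "(case \<sigma> of (a0, _) \<Rightarrow> lookup (X_zero C T) a0) = T (basis \<sigma>)"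
      \<comment> \<open>In degree 0 no morphism is composed with the endomorphism, so the indexing
        map is the identity.\<close>
      using lookup_sum_fscale_basis[OF finite_endos[OF assms(2)], of "\<lambda>a. a"]
      by (simp add: X_zero_def)
  qed
  fix m :: nat assume m: "1 \<le> m"
  show "linear_on (map_scale (*)) (map_scale fscale)
          (nerve_cochains (adjoint_category C) m ::
             (('m \<times> ('m \<times> 'm \<times> 'm) list \<Rightarrow>\<^sub>0 'k::field) \<Rightarrow> 'k) set)
          (hochschild_cochains C m) (X_map C m)"
    unfolding linear_on_def
  proof (intro conjI ballI allI)
    fix T U :: "('m \<times> ('m \<times> 'm \<times> 'm) list \<Rightarrow>\<^sub>0 'k) \<Rightarrow> 'k" and c
    show "X_map C m T \<in> hochschild_cochains C m"
      unfolding X_map_def hochschild_cochains_def tensor_power_def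
      \<comment> \<open>Words that are not composable give 0; composable ones give combinations of
        composites, which are morphisms.\<close>
      by (rule lin_ext_in_linear_maps[OF vector_space_fscale subspace_free_space])
        (auto simp: Let_def f.subspace_0[OF subspace_free_space] Hom_def
          intro!: sum_fscale_basis_in_free_space fold_Comp_in)
    show "X_map C m (T + U) = X_map C m T + X_map C m U"
      \<comment> \<open>Read from right to left, the rule merges the sum into one extension, leaving
        only prescribed values to compare.\<close>
      unfolding X_map_def lin_ext_add[OF vector_space_fscale, symmetric]
      by (intro arg_cong[where f = "lin_ext _ _"] ext)
        (simp add: Let_def f.scale_left_distrib sum.distrib)
    show "X_map C m (map_scale (*) c T) = map_scale fscale c (X_map C m T)"
      unfolding X_map_def lin_ext_scale[OF vector_space_fscale, symmetric]
      by (intro arg_cong[where f = "lin_ext _ _"] ext)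
        (simp add: Let_def map_scale_def f.scale_sum_right)
  qed
  show "T_map C m (X_map C m T) = T"
    if "T \<in> nerve_cochains (adjoint_category C) m"
    for T :: "('m \<times> ('m \<times> 'm \<times> 'm) list \<Rightarrow>\<^sub>0 'k) \<Rightarrow> 'k"
    unfolding T_map_def
  proof (rule lin_ext_eqI[OF vector_space_field that[unfolded nerve_cochains_def]])
    fix \<sigma> assume "\<sigma> \<in> nerve (adjoint_category C) m"
    then obtain a fs where \<sigma>: "\<sigma> = (a, fs)" "path (adjoint_category C) a fs" "length fs = m"
      by (auto simp: nerve_def)
    define gs where "gs = map underlying fs"
    define x where "x = Src C a"
    have a: "a \<in> End C x" and x: "x \<in> Obj C" and gs: "path C x gs"
      using path_underlying[OF \<sigma>(2)] Src_in[of a] endos_iff[of a]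
      by (auto simp: x_def gs_def Hom_def)
    \<comment> \<open>\<open>hd gs\<close> is meaningful because \<open>m \<ge> 1\<close> makes
      \<open>gs\<close> nonempty.\<close>
    have hd: "Src C (hd gs) = x" using gs m \<sigma>(3) by (cases gs) (auto simp: gs_def)
    have "set gs \<subseteq> Mor C" by (rule path_subset_Mor[OF gs])
    then have w: "rev gs \<in> words m (Mor C)"
      using \<sigma>(3) by (simp add: words_def gs_def)
    have fin: "finite (End C x)" using assms(2) x by (simp add: finite_category_def)
    \<comment> \<open>All endomorphisms of \<open>x\<close> have target \<open>x\<close>, the start
      of the path, so left cancellation applies along \<open>gs\<close>.\<close>
    have inj: "inj_on (fold (Comp C) gs) (End C x)"
      using fold_Comp_inj[OF lc gs] by (auto simp: inj_on_def Hom_def)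
    have "lookup (X_map C m T (basis (rev gs))) (fold (Comp C) gs a)
        = T (basis (lift_chain C gs a))"
      \<comment> \<open>\<open>X_map\<close> reverses the tensor word \<open>rev gs\<close> back to
        \<open>gs\<close>; this is a path from \<open>x\<close>, so the nonzero branch is
        taken.\<close>
      using lookup_sum_fscale_basis[OF fin inj a, of "\<lambda>a. T (basis (lift_chain C gs a))"] gs
      by (simp add: X_map_def lin_ext_basis[OF vector_space_fscale w] hd)
    also have "lift_chain C gs a = \<sigma>"
      unfolding gs_def \<sigma>(1) by (rule lift_chain_eq[OF rc \<sigma>(2)])
    finally show "(case \<sigma> of (a0, fs) \<Rightarrow> let gs = map underlying fs
        in lookup (X_map C m T (tensor (map basis (rev gs)))) (fold (Comp C) gs a0)) = T (basis \<sigma>)"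
      by (simp add: \<sigma>(1) gs_def tensor_basis Let_def)
  qed
qed

end
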